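(* Let $T$ be a tournament on $3$ or more vertices with a transmitter $s$ and a receiver $t$. Then $T$ is quadrangular if and only if both $\gamma(T-\{s,t\})>2$ and $\gamma((T-\{s,t\})^{r})>2$.
   Context: A tournament $T$ is a digraph with no loops such that for each pair of distinct vertices $u\neq v$ exactly one of the arcs $(u,v)$, $(v,u)$ is present; $u\rightarrow v$ means $(u,v)$ is an arc. For a vertex $v$, $O(v)=\{u:v\rightarrow u\}$ (outset) and $I(v)=\{u:u\rightarrow v\}$ (inset). A digraph $D$ is quadrangular if for all distinct vertices $u\neq v$, $|O(u)\cap O(v)|\neq 1$ and $|I(u)\cap I(v)|\neq 1$. A transmitter is a vertex dominating all other vertices; a receiver is a vertex dominated by all other vertices. $T-\{s,t\}$ is the subtournament induced on $V(T)\setminus\{s,t\}$. The dual (reversal) $T^{r}$ of a tournament $T$ has the same vertices, with $x\rightarrow y$ in $T^r$ iff $y\rightarrow x$ in $T$. A dominating set of a digraph $D$ is a set $S$ of vertices such that every vertex is in $S$ or dominated by a vertex of $S$; $\gamma(D)$ is the minimum size of a dominating set. *)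

theory Defs
  imports "Graph_Theory.Graph_Theory"
begin

locale tournament = digraph +
  assumes exactly_one_arc:
    "\<lbrakk>u \<in> verts G; v \<in> verts G; u \<noteq> v\<rbrakk> \<Longrightarrow> (u \<rightarrow>\<^bsub>G\<^esub> v) \<longleftrightarrow> \<not> (v \<rightarrow>\<^bsub>G\<^esub> u)"

definition outset :: "('a, 'b) pre_digraph \<Rightarrow> 'a \<Rightarrow> 'a set" where
  "outset D v = {u. v \<rightarrow>\<^bsub>D\<^esub> u}"

definition inset :: "('a, 'b) pre_digraph \<Rightarrow> 'a \<Rightarrow> 'a set" where
  "inset D v = {u. u \<rightarrow>\<^bsub>D\<^esub> v}"

definition quadrangular :: "('a, 'b) pre_digraph \<Rightarrow> bool" where
  "quadrangular D \<longleftrightarrow>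
    (\<forall>u\<in>verts D. \<forall>v\<in>verts D. u \<noteq> v \<longrightarrow>
      card (outset D u \<inter> outset D v) \<noteq> 1 \<and> card (inset D u \<inter> inset D v) \<noteq> 1)"

definition transmitter :: "('a, 'b) pre_digraph \<Rightarrow> 'a \<Rightarrow> bool" where
  "transmitter D s \<longleftrightarrow> s \<in> verts D \<and> (\<forall>v\<in>verts D - {s}. s \<rightarrow>\<^bsub>D\<^esub> v)"

definition receiver :: "('a, 'b) pre_digraph \<Rightarrow> 'a \<Rightarrow> bool" where
  "receiver D t \<longleftrightarrow> t \<in> verts D \<and> (\<forall>v\<in>verts D - {t}. v \<rightarrow>\<^bsub>D\<^esub> t)"

definition dual :: "('a, 'b) pre_digraph \<Rightarrow> ('a, 'b) pre_digraph" where
  "dual D = \<lparr>verts = verts D, arcs = arcs D, tail = head D, head = tail D\<rparr>"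

definition dominating_set :: "('a, 'b) pre_digraph \<Rightarrow> 'a set \<Rightarrow> bool" where
  "dominating_set D S \<longleftrightarrow> S \<subseteq> verts D \<and> (\<forall>v\<in>verts D. v \<in> S \<or> (\<exists>u\<in>S. u \<rightarrow>\<^bsub>D\<^esub> v))"

text \<open>Meaningful only for finite \<open>D\<close>; the minimum then exists, since \<open>verts D\<close> is dominating.\<close>
definition domination_number :: "('a, 'b) pre_digraph \<Rightarrow> nat" where
  "domination_number D = Min (card ` {S. dominating_set D S})"

lemma dominates_dual_iff: "(x \<rightarrow>\<^bsub>dual D\<^esub> y) \<longleftrightarrow> (y \<rightarrow>\<^bsub>D\<^esub> x)"
  by (auto simp: dual_def arcs_ends_conv)

lemma dominates_induce_iff:
  "(x \<rightarrow>\<^bsub>D \<restriction> V\<^esub> y) \<longleftrightarrow> (x \<rightarrow>\<^bsub>D\<^esub> y) \<and> x \<in> V \<and> y \<in> V"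
  by (auto simp: arcs_ends_conv)

end

theory Submission
  imports Defs
begin

text \<open>
  In a tournament a pair \<open>{u, v}\<close> fails to be dominating exactly when \<open>u\<close> and \<open>v\<close> have a common
  in-neighbour, so the domination number exceeds 2 iff any two (possibly equal) vertices have one.
  For \<open>u\<close>, \<open>v\<close> other than \<open>s\<close> and \<open>t\<close>, the transmitter \<open>s\<close> is always one common in-neighbour
  in \<open>T\<close>, hence the intersection of insets is not a singleton iff there is a further common
  in-neighbour in \<open>T - {s, t}\<close>. Pairing \<open>u\<close> with \<open>t\<close> gives the case \<open>u = v\<close>, and
  pairs containing \<open>s\<close> have no common in-neighbour at all. Outsets follow by duality.
\<close>

lemma tournament_dual:
  assumes "tournament T"
  shows "tournament (dual T)"
proof -
  interpret tournament T by fact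
  \<comment> \<open>Parallel arcs of \<open>dual T\<close> are parallel arcs of \<open>T\<close>
    read backwards, so \<open>no_multi_arcs\<close> carries over.\<close>
  have "a = b" if "a \<in> arcs T" "b \<in> arcs T" "head T a = head T b" "tail T a = tail T b" for a b
    using no_multi_arcs that by (simp add: arc_to_ends_def)
  then interpret dual: digraph "dual T"
    by unfold_locales (auto simp: dual_def arc_to_ends_def dest: no_loops)
  show ?thesis
  proof
    fix u v assume "u \<in> verts (dual T)" "v \<in> verts (dual T)" "u \<noteq> v"
    then show "u \<rightarrow>\<^bsub>dual T\<^esub> v \<longleftrightarrow> \<not> v \<rightarrow>\<^bsub>dual T\<^esub> u"
      using exactly_one_arc[of v u] by (simp add: dominates_dual_iff) (simp add: dual_def)
  qed
qed

lemma tournament_induce_subgraph: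
  assumes "tournament T" and "W \<subseteq> verts T"
  shows "tournament (T \<restriction> W)"
proof -
  interpret tournament T by fact
  interpret W: digraph "T \<restriction> W"
    using assms(2) by (intro digraphI_induced induced_induce)
  show ?thesis
    using assms(2) exactly_one_arc by unfold_locales (auto simp: dominates_induce_iff)
qed

lemma dual_induce_subgraph: "dual (T \<restriction> W) = dual T \<restriction> W"
  by (auto simp: dual_def induce_subgraph_def)

lemma inset_dual: "inset (dual T) v = outset T v"
  by (simp add: inset_def outset_def dominates_dual_iff)

lemma transmitter_dual: "transmitter (dual T) s \<longleftrightarrow> receiver T s"
  by (simp add: transmitter_def receiver_def dominates_dual_iff) (simp add: dual_def)

lemma receiver_dual: "receiver (dual T) t \<longleftrightarrow> transmitter T t"
  by (simp add: transmitter_def receiver_def dominates_dual_iff) (simp add: dual_def)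

text \<open>Since \<open>u = v\<close> is allowed, the pairs \<open>{u, v}\<close> cover the
  dominating sets of size 1 as well as 2. Size 0 is excluded by \<open>verts D \<noteq> {}\<close>:
  the empty set dominates an empty digraph, whose right-hand side holds vacuously.\<close>

lemma domination_number_gt_2_iff:
  assumes "finite (verts D)" and "verts D \<noteq> {}"
  shows "domination_number D > 2 \<longleftrightarrow> (\<forall>u\<in>verts D. \<forall>v\<in>verts D. \<not> dominating_set D {u, v})"
proof -
  have "{S. dominating_set D S} \<subseteq> Pow (verts D)"
    by (auto simp: dominating_set_def)
  then have "finite {S. dominating_set D S}"
    using assms(1) by (simp add: finite_subset)
  \<comment> \<open>This witness makes the family nonempty, as \<open>Min_gr_iff\<close>
    demands.\<close>
  moreover have "dominating_set D (verts D)"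
    by (simp add: dominating_set_def)
  ultimately have "domination_number D > 2 \<longleftrightarrow> (\<forall>S. dominating_set D S \<longrightarrow> card S > 2)"
    unfolding domination_number_def by (subst Min_gr_iff) auto
  also have "\<dots> \<longleftrightarrow> (\<forall>u\<in>verts D. \<forall>v\<in>verts D. \<not> dominating_set D {u, v})"
  proof (intro iffI ballI allI impI notI)
    fix u v
    assume "\<forall>S. dominating_set D S \<longrightarrow> card S > 2" and "dominating_set D {u, v}"
    then show False
      using card_insert_le_m1[of 2 "{v}" u] by fastforce
  next
    fix S
    assume no_pair: "\<forall>u\<in>verts D. \<forall>v\<in>verts D. \<not> dominating_set D {u, v}"
      and S: "dominating_set D S"
    have "S \<subseteq> verts D" "S \<noteq> {}"
      using S assms(2) by (auto simp: dominating_set_def)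
    moreover from this have "finite S"
      using assms(1) by (blast intro: finite_subset)
    moreover have "card S \<noteq> 1"
    proof
      assume "card S = 1"
      then obtain u where "S = {u}"
        by (rule card_1_singletonE)
      then show False
        using no_pair[rule_format, of u u] S \<open>S \<subseteq> verts D\<close> by simp
    qed
    moreover have "card S \<noteq> 2"
      using no_pair S \<open>S \<subseteq> verts D\<close> by (auto simp: card_2_iff)
    ultimately show "card S > 2"
      using card_gt_0_iff[of S] by linarith
  qed
  finally show ?thesis .
qed

text \<open>A vertex left undominated by \<open>{u, v}\<close> differs from both and hence, by
  \<open>exactly_one_arc\<close>, dominates both. Conversely, a common in-neighbour is neither of
  them, as there are no loops, and receives no arc from them. The case \<open>u = v\<close> is
  included.\<close>

lemma (in tournament) dominating_pair_iff:
  assumes "u \<in> verts G" "v \<in> verts G"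
  shows "dominating_set G {u, v} \<longleftrightarrow> inset G u \<inter> inset G v = {}"
proof -
  have "w \<rightarrow>\<^bsub>G\<^esub> x \<longleftrightarrow> w \<in> verts G \<and> w \<noteq> x \<and> \<not> (x \<rightarrow>\<^bsub>G\<^esub> w)" if "x \<in> verts G" for w x
    using that exactly_one_arc adj_in_verts(1) adj_not_same by blast
  then show ?thesis
    using assms unfolding dominating_set_def inset_def by blast
qed

text \<open>This is the inset half of quadrangularity; applied to \<open>dual T\<close> it also
  yields the outset half.\<close>

lemma card_inter_inset_ne_1_iff_domination_number:
  assumes "tournament T" and "card (verts T) \<ge> 3" and s: "transmitter T s" and t: "receiver T t"
  shows "(\<forall>u\<in>verts T. \<forall>v\<in>verts T. u \<noteq> v \<longrightarrow> card (inset T u \<inter> inset T v) \<noteq> 1) \<longleftrightarrow>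
    domination_number (T \<restriction> (verts T - {s, t})) > 2"
proof -
  interpret tournament T by fact
  define W where "W = verts T - {s, t}"
  let ?D = "T \<restriction> W"
  interpret D: tournament ?D
    using assms(1) by (rule tournament_induce_subgraph) (auto simp: W_def)
  have "card (verts T) \<le> card W + card {s, t}"
    unfolding W_def using diff_card_le_card_Diff[of "{s, t}" "verts T"] by simp
  moreover have "card {s, t} \<le> 2"
    by (simp add: card_insert_if)
  ultimately have "W \<noteq> {}"
    using assms(2) by auto
  have D_iff: "domination_number ?D > 2 \<longleftrightarrow> (\<forall>u\<in>W. \<forall>v\<in>W. inset ?D u \<inter> inset ?D v \<noteq> {})"
    using domination_number_gt_2_iff[of ?D] D.dominating_pair_iff D.finite_verts \<open>W \<noteq> {}\<close> by simp
  have inset_s: "inset T s = {}"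
    using s exactly_one_arc adj_in_verts(1) adj_not_same
    unfolding inset_def transmitter_def by blast
  have inset_t: "inset T t = verts T - {t}"
    using t adj_in_verts(1) adj_not_same unfolding inset_def receiver_def by blast
  \<comment> \<open>Of the deleted vertices only \<open>s\<close> sends an arc to \<open>u\<close>;
    the arc between \<open>u\<close> and \<open>t\<close> ends in \<open>t\<close>.\<close>
  have inset_W: "inset T u = insert s (inset ?D u)" if "u \<in> W" for u
    using that s t exactly_one_arc adj_in_verts(1)
    unfolding W_def inset_def transmitter_def receiver_def dominates_induce_iff by blast
  have finite_inset: "finite (inset ?D u)" and s_notin: "s \<notin> inset ?D u" for u
    by (auto simp: inset_def dominates_induce_iff W_def intro: finite_subset[OF _ finite_verts])
  have pair: "card (inset T u \<inter> inset T v) \<noteq> 1 \<longleftrightarrow> inset ?D u \<inter> inset ?D v \<noteq> {}"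
    if "u \<in> W" "v \<in> W" for u v
  proof -
    have "inset T u \<inter> inset T v = insert s (inset ?D u \<inter> inset ?D v)"
      using that by (auto simp: inset_W)
    then show ?thesis
      \<comment> \<open>As \<open>s\<close> is a new element of a finite set, it adds exactly 1 to
        the cardinality, which is then 1 iff the rest is empty.\<close>
      using finite_inset s_notin by simp
  qed
  have with_t: "inset T u \<inter> inset T t = inset T u" if "u \<in> W" for u
    using that t exactly_one_arc adj_in_verts(1)
    unfolding inset_t by (auto simp: W_def inset_def receiver_def)
  have verts_cases: "u = s \<or> u = t \<or> u \<in> W" if "u \<in> verts T" for u
    using that by (auto simp: W_def)
  have W_t: "t \<in> verts T" "u \<in> verts T" "u \<noteq> t" if "u \<in> W" for u
    using that t by (auto simp: W_def receiver_def)
  have "(\<forall>u\<in>verts T. \<forall>v\<in>verts T. u \<noteq> v \<longrightarrow> card (inset T u \<inter> inset T v) \<noteq> 1) \<longleftrightarrow>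
    (\<forall>u\<in>W. \<forall>v\<in>W. card (inset T u \<inter> inset T v) \<noteq> 1)" (is "?L \<longleftrightarrow> ?R")
  proof
    assume ?L
    show ?R
    proof (intro ballI)
      fix u v assume "u \<in> W" "v \<in> W"
      show "card (inset T u \<inter> inset T v) \<noteq> 1"
      proof (cases "u = v")
        case True
        \<comment> \<open>\<open>?L\<close> covers distinct vertices only, so \<open>t\<close>
          replaces the second copy of \<open>u\<close>; by \<open>with_t\<close> the intersection is
          still \<open>inset T u\<close>.\<close>
        have "card (inset T u \<inter> inset T t) \<noteq> 1"
          using \<open>?L\<close> W_t \<open>u \<in> W\<close> by blast
        then show ?thesis
          using True with_t \<open>u \<in> W\<close> by simp
      next
        case False
        then show ?thesis
          using \<open>?L\<close> W_t \<open>u \<in> W\<close> \<open>v \<in> W\<close> by blast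
      qed
    qed
  next
    assume ?R
    have R_t: "card (inset T u \<inter> inset T t) \<noteq> 1" if "u \<in> W" for u
      using \<open>?R\<close> that with_t by fastforce
    show ?L
    proof (intro ballI impI)
      fix u v assume "u \<in> verts T" "v \<in> verts T" "u \<noteq> v"
      then consider "u = s \<or> v = s" | "u \<in> W" "v = t" | "u = t" "v \<in> W" | "u \<in> W" "v \<in> W"
        using verts_cases by blast
      then show "card (inset T u \<inter> inset T v) \<noteq> 1"
      proof cases
        case 1
        then show ?thesis by (auto simp: inset_s)
      next
        case 2
        then show ?thesis using R_t by simp
      next
        case 3
        then show ?thesis using R_t by (metis Int_commute)
      next
        case 4
        then show ?thesis using \<open>?R\<close> by blast
      qed
    qed
  qed
  then show ?thesis
    using D_iff pair unfolding W_def by simp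
qed

theorem theorem1:
  fixes T :: "('a, 'b) pre_digraph" and s t :: 'a
  assumes "tournament T"
    and "card (verts T) \<ge> 3"
    and "transmitter T s"
    and "receiver T t"
  shows "quadrangular T \<longleftrightarrow>
    domination_number (T \<restriction> (verts T - {s, t})) > 2 \<and>
    domination_number (dual (T \<restriction> (verts T - {s, t}))) > 2"
proof -
  have verts_dual: "verts (dual T) = verts T"
    by (simp add: dual_def)
  have "(\<forall>u\<in>verts T. \<forall>v\<in>verts T. u \<noteq> v \<longrightarrow> card (outset T u \<inter> outset T v) \<noteq> 1) \<longleftrightarrow>
    domination_number (dual (T \<restriction> (verts T - {s, t}))) > 2"
    \<comment> \<open>Reversal exchanges transmitter and receiver, hence the order
      \<open>t s\<close>; \<open>insert_commute\<close> reconciles \<open>{t, s}\<close> with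
      \<open>{s, t}\<close>.\<close>
    using card_inter_inset_ne_1_iff_domination_number[of "dual T" t s] tournament_dual[OF assms(1)] assms
    by (simp add: verts_dual inset_dual transmitter_dual receiver_dual dual_induce_subgraph
        insert_commute)
  then show ?thesis
    using card_inter_inset_ne_1_iff_domination_number[OF assms]
    unfolding quadrangular_def by blast
qed

end
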